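(* Let $\Delta:\mathbb{N}^{(2)}\to\mathbb{N}$ be an infinite colouring and let $n\geq 2$ be a natural number. Then $\left|\mathcal{G}_{\Delta}\cap\left[\binom{n}{2}\right]\right|\geq n-1$.
   Context: For a set $X$, $X^{(2)}$ denotes the set of unordered pairs of elements of $X$, and $[N]=\{1,\dots,N\}$. A colouring $\Delta:\mathbb{N}^{(2)}\to\mathbb{N}$ is infinite if its image is infinite. A set $X\subset\mathbb{N}$ is (exactly) $m$-coloured if $\Delta(X^{(2)})$ has exactly $m$ elements. Define $\mathcal{G}_{\Delta}=\{m\in\mathbb{N} : \text{there is a (finite or infinite) } X\subset\mathbb{N} \text{ that is } m\text{-coloured}\}$. *)

theory Defs
  imports Complex_Main "HOL-Library.Ramsey"
begin

(* Only the values of a colouring on two-element sets matter; its values on other sets of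
   naturals are never inspected. *)

definition infinite_colouring :: "(nat set \<Rightarrow> nat) \<Rightarrow> bool" where
  "infinite_colouring \<Delta> \<longleftrightarrow> infinite (\<Delta> ` [UNIV]\<^bsup>2\<^esup>)"

(* The finiteness conjunct is needed because the cardinality of an infinite set is 0. *)
definition exactly_coloured :: "(nat set \<Rightarrow> nat) \<Rightarrow> nat \<Rightarrow> nat set \<Rightarrow> bool" where
  "exactly_coloured \<Delta> m X \<longleftrightarrow> finite (\<Delta> ` [X]\<^bsup>2\<^esup>) \<and> card (\<Delta> ` [X]\<^bsup>2\<^esup>) = m"

definition colour_counts :: "(nat set \<Rightarrow> nat) \<Rightarrow> nat set" where
  "colour_counts \<Delta> = {m. \<exists>X. exactly_coloured \<Delta> m X}"

end

theory Submission
  imports Defs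
begin

text \<open>For every \<open>k \<ge> 1\<close> the interval from \<open>(k choose 2) + 1\<close> to \<open>(k + 1) choose 2\<close> contains a colour
  count, namely that of a smallest set \<open>Y\<close> seeing more than \<open>m = k choose 2\<close> colours. Let it see
  \<open>m + d\<close> colours. Deleting any vertex destroys at least \<open>d\<close> colours, and each colour is destroyed by
  at most two vertices, so \<open>|Y| d \<le> 2 (m + d)\<close>. If \<open>|Y| \<ge> k + 2\<close>, this gives \<open>k d \<le> 2 m = k (k - 1)\<close>,
  so \<open>d < k\<close>; otherwise \<open>m + d \<le> |Y| choose 2 \<le> (k + 1) choose 2\<close>.\<close>

text \<open>Double counting of the pairs of a vertex \<open>v\<close> and a colour \<open>c\<close>
  such that deleting \<open>v\<close> destroys \<open>c\<close>: summing over vertices bounds their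
  number below, summing over colours bounds it above. If \<open>Y\<close> sees at most
  \<open>m\<close> colours, truncated subtraction makes the left side zero.\<close>

lemma card_times_lost_colours_le:
  fixes \<Delta> :: "'a set \<Rightarrow> 'b"
  assumes fin: "finite Y"
    and few: "\<And>v. v \<in> Y \<Longrightarrow> card (\<Delta> ` [Y - {v}]\<^bsup>2\<^esup>) \<le> m"
  shows "card Y * (card (\<Delta> ` [Y]\<^bsup>2\<^esup>) - m) \<le> 2 * card (\<Delta> ` [Y]\<^bsup>2\<^esup>)"
proof -
  let ?C = "\<Delta> ` [Y]\<^bsup>2\<^esup>"
  let ?R = "\<lambda>v c. c \<notin> \<Delta> ` [Y - {v}]\<^bsup>2\<^esup>"
  have finC: "finite ?C"
    using fin by (simp add: finite_imp_finite_nsets)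
  have lost: "card ?C - m \<le> card {c \<in> ?C. ?R v c}" if "v \<in> Y" for v
  proof -
    have fin': "finite (\<Delta> ` [Y - {v}]\<^bsup>2\<^esup>)"
      using fin by (simp add: finite_imp_finite_nsets)
    have "card ?C - m \<le> card ?C - card (\<Delta> ` [Y - {v}]\<^bsup>2\<^esup>)"
      using few[OF that] by simp
    also have "\<dots> \<le> card (?C - \<Delta> ` [Y - {v}]\<^bsup>2\<^esup>)"
      using fin' by (rule diff_card_le_card_Diff)
    also have "?C - \<Delta> ` [Y - {v}]\<^bsup>2\<^esup> = {c \<in> ?C. ?R v c}"
      by blast
    finally show ?thesis .
  qed
  have killers: "card {v \<in> Y. ?R v c} \<le> 2" if "c \<in> ?C" for c
  proof -
    obtain e where e: "e \<in> [Y]\<^bsup>2\<^esup>" "c = \<Delta> e"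
      using \<open>c \<in> ?C\<close> by blast
    \<comment> \<open>A vertex outside \<open>e\<close> leaves the pair \<open>e\<close> intact, so
      the colour \<open>c\<close> survives its deletion.\<close>
    have "{v \<in> Y. ?R v c} \<subseteq> e"
      using e by (auto simp: nsets_def)
    with e show ?thesis
      by (metis (mono_tags, lifting) card_mono mem_Collect_eq nsets_def)
  qed
  have "card Y * (card ?C - m) \<le> (\<Sum>v\<in>Y. card {c \<in> ?C. ?R v c})"
    using sum_bounded_below[of Y "card ?C - m"] lost by simp
  also have "\<dots> = (\<Sum>c\<in>?C. card {v \<in> Y. ?R v c})"
    using fin finC by (rule sum_multicount_gen) simp
  also have "\<dots> \<le> 2 * card ?C"
    using sum_bounded_above[of ?C "\<lambda>c. card {v \<in> Y. ?R v c}" 2] killers by (simp add: mult.commute)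
  finally show ?thesis .
qed

text \<open>Choose \<open>m + 1\<close> colours and finitely many pairs realising them; the union of
  these pairs is a finite set that sees all the chosen colours.\<close>

lemma infinite_colouring_many_colours:
  assumes "infinite_colouring \<Delta>"
  shows "\<exists>Y. finite Y \<and> card (\<Delta> ` [Y]\<^bsup>2\<^esup>) > m"
proof -
  obtain T where T: "T \<subseteq> \<Delta> ` [UNIV]\<^bsup>2\<^esup>" "finite T" "card T = Suc m"
    using assms unfolding infinite_colouring_def by (meson infinite_arbitrarily_large)
  then obtain E where E: "E \<subseteq> [UNIV]\<^bsup>2\<^esup>" "finite E" "T = \<Delta> ` E"
    by (meson finite_subset_image)
  have fin: "finite (\<Union>E)"
    using E by (auto simp: nsets_def)
  have "T \<subseteq> \<Delta> ` [\<Union>E]\<^bsup>2\<^esup>"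
    using E by (auto simp: nsets_def)
  then have "card T \<le> card (\<Delta> ` [\<Union>E]\<^bsup>2\<^esup>)"
    using fin by (simp add: card_mono finite_imp_finite_nsets)
  with fin T show ?thesis
    by (metis Suc_le_lessD)
qed

lemma colour_count_between_triangular_numbers:
  assumes "infinite_colouring \<Delta>" and "k \<ge> 1"
  shows "\<exists>c \<in> colour_counts \<Delta>. k choose 2 < c \<and> c \<le> Suc k choose 2"
proof -
  let ?c = "\<lambda>Y. card (\<Delta> ` [Y]\<^bsup>2\<^esup>)"
  let ?P = "\<lambda>Y. finite Y \<and> ?c Y > k choose 2"
  obtain Y where Y: "?P Y" and least: "\<And>Z. ?P Z \<Longrightarrow> card Y \<le> card Z"
    using infinite_colouring_many_colours[OF assms(1)]
      exists_least_iff[of "\<lambda>i. \<exists>Y. ?P Y \<and> card Y = i"]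
    by (metis (no_types, lifting) linorder_not_less)
  have few: "?c (Y - {v}) \<le> k choose 2" if "v \<in> Y" for v
    using least[of "Y - {v}"] Y that
    by (metis card_Diff1_less finite_Diff linorder_not_less)
  have bound: "card Y * (?c Y - (k choose 2)) \<le> 2 * ?c Y"
    using card_times_lost_colours_le Y few by blast
  have succ: "Suc k choose 2 = (k choose 2) + k"
    by (simp add: numeral_2_eq_2)
  have "?c Y \<le> Suc k choose 2"
  proof (cases "card Y \<le> Suc k")
    case True
    have "?c Y \<le> card ([Y]\<^bsup>2\<^esup>)"
      using Y by (intro card_image_le finite_imp_finite_nsets) simp
    also have "\<dots> = card Y choose 2"
      by simp
    also have "\<dots> \<le> Suc k choose 2"
      using True by (rule binomial_right_mono)
    finally show ?thesis .
  next
    case False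
    define d where "d = ?c Y - (k choose 2)"
    have cY: "?c Y = (k choose 2) + d"
      using Y by (simp add: d_def)
    \<comment> \<open>The \<open>2\<close> in \<open>k + 2\<close> matters: it contributes
      \<open>2 * d\<close>, which cancels against the \<open>2 * d\<close> coming from
      \<open>2 * ?c Y\<close>.\<close>
    have "(k + 2) * d \<le> card Y * d"
      using False by (intro mult_right_mono) auto
    also have "\<dots> \<le> 2 * (k choose 2) + 2 * d"
      using bound cY by simp
    finally have "k * d \<le> 2 * (k choose 2)"
      by simp
    also have "\<dots> = k * (k - 1)"
      using times_binomial_minus1_eq[of 2 k] by simp
    \<comment> \<open>Cancelling \<open>k\<close> is where \<open>k \<ge> 1\<close> enters.\<close>
    finally have "d \<le> k - 1"
      using assms(2) by simp
    then show ?thesis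
      using cY succ by simp
  qed
  moreover have "?c Y \<in> colour_counts \<Delta>"
    using Y unfolding colour_counts_def exactly_coloured_def
    by (blast intro: finite_imageI finite_imp_finite_nsets)
  ultimately show ?thesis
    using Y by blast
qed

theorem theorem3:
  fixes \<Delta> :: "nat set \<Rightarrow> nat" and n :: nat
  assumes "infinite_colouring \<Delta>" and "n \<ge> 2"
  shows "card (colour_counts \<Delta> \<inter> {1..n choose 2}) \<ge> n - 1"
proof -
  obtain g where g: "\<And>k. k \<ge> 1 \<Longrightarrow> g k \<in> colour_counts \<Delta> \<and> k choose 2 < g k \<and> g k \<le> Suc k choose 2"
    using colour_count_between_triangular_numbers[OF assms(1)] by metis
  \<comment> \<open>Distinct indices give disjoint intervals, since the one for \<open>j\<close>
    ends at \<open>Suc j choose 2\<close>, no later than the excluded lower end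
    \<open>k choose 2\<close> of the one for \<open>k\<close>.\<close>
  have less: "g j < g k" if "1 \<le> j" "j < k" for j k
  proof -
    have "g j \<le> Suc j choose 2"
      using g that by simp
    also have "\<dots> \<le> k choose 2"
      using that by (intro binomial_right_mono) simp
    also have "\<dots> < g k"
      using g that by simp
    finally show ?thesis .
  qed
  \<comment> \<open>The \<open>n - 1\<close> indices below \<open>n\<close> are exactly those whose
    intervals tile \<open>{1..n choose 2}\<close>, starting from
    \<open>1 choose 2 = 0\<close>.\<close>
  have "inj_on g {1..<n}"
    by (rule linorder_inj_onI') (metis atLeastLessThan_iff less less_irrefl)
  then have "n - 1 = card (g ` {1..<n})"
    by (simp add: card_image)
  also have "\<dots> \<le> card (colour_counts \<Delta> \<inter> {1..n choose 2})"
  proof (rule card_mono)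
    show "g ` {1..<n} \<subseteq> colour_counts \<Delta> \<inter> {1..n choose 2}"
    proof
      fix c assume "c \<in> g ` {1..<n}"
      then obtain k where k: "1 \<le> k" "Suc k \<le> n" "c = g k"
        by auto
      have "Suc k choose 2 \<le> n choose 2"
        using k(2) by (rule binomial_right_mono)
      then show "c \<in> colour_counts \<Delta> \<inter> {1..n choose 2}"
        using g[OF k(1)] k(3) by auto
    qed
  qed simp
  finally show ?thesis .
qed

end
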